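(* For any $a\in\mathbb{N}$ and $b,c\in\mathbb{N}_0$, $$t^{\star}(\{2\}^{a},1,\{2\}^{b},3,\{2\}^{c})=-\frac{4}{\pi}t(\overline{2a+2b+2c+5})-\frac{8}{\pi}t(2a+1,\overline{2b+2c+4})-\frac{8}{\pi}t(\overline{2a+2b+3},2c+2)-\frac{16}{\pi}t(2a+1,\overline{2b+2},2c+2)$$ and $$t^{\star}(\{2\}^{a},1,\{2\}^{b},1,\{2\}^{c})=-\frac{4}{\pi}t(\overline{2a+2b+2c+3})-\frac{8}{\pi}t(2a+1,\overline{2b+2c+2})-\frac{8}{\pi}t(2a+2b+2,\overline{2c+1})-\frac{16}{\pi}t(2a+1,2b+1,\overline{2c+1}).$$
   Context: $t^{\star}(\boldsymbol{s})=\sum_{k_1\geq\cdots\geq k_r\geq1}\prod_{j}(2k_j-1)^{-s_j}$ for an index with $s_1>1$; $\{2\}^a$ is $2$ repeated $a$ times. Alternating multiple $t$-values: $t(\boldsymbol{s};\boldsymbol{\sigma})=\sum_{k_1>\cdots>k_r\geq1}\prod_{j}\frac{\sigma_j^{k_j}}{(2k_j-1)^{s_j}}$, where a bar over $s_j$ means $\sigma_j=-1$ and no bar means $\sigma_j=1$. *)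

theory Defs
  imports "HOL-Analysis.Analysis"
begin

text \<open>Multiple t-star value: sum over k_1 \<ge> ... \<ge> k_r \<ge> 1 of prod_j (2k_j - 1)^(-s_j).
  Defined as an (unordered) infinite sum over the index tuples; for the admissible
  indices (s_1 > 1) the series is absolutely convergent.\<close>
definition tstar :: "nat list \<Rightarrow> real" where
  "tstar s = infsum (\<lambda>ks. \<Prod>j<length s. 1 / (2 * real (ks ! j) - 1) ^ (s ! j))
     {ks. length ks = length s \<and> sorted_wrt (\<ge>) ks \<and> (\<forall>k\<in>set ks. 1 \<le> k)}"

text \<open>Alternating multiple t-value. An index entry is a pair (s_j, barred_j);
  barred means sigma_j = -1, otherwise sigma_j = 1.
  Sum over k_1 > ... > k_r \<ge> 1 of prod_j sigma_j^(k_j) / (2k_j - 1)^(s_j).\<close>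
definition tval :: "(nat \<times> bool) list \<Rightarrow> real" where
  "tval s = infsum (\<lambda>ks. \<Prod>j<length s.
       (if snd (s ! j) then (-1) ^ (ks ! j) else 1) / (2 * real (ks ! j) - 1) ^ (fst (s ! j)))
     {ks. length ks = length s \<and> sorted_wrt (>) ks \<and> (\<forall>k\<in>set ks. 1 \<le> k)}"

end

theory Submission
  imports Defs
begin

text \<open>
  Write \<open>o\<^sub>k = 2k - 1\<close>. The partial fraction decomposition of
  \<open>\<Prod>k\<le>N. 1 / (1 - x\<^sup>2 / o\<^sub>k\<^sup>2)\<close> in \<open>x\<^sup>2\<close> has the coefficients
  \<open>(-1) ^ (n + 1) * K N n / o\<^sub>n\<close>, and every truncated star sum considered here is
  \<open>\<Sum>n\<le>N. K N n * e n\<close> for a sequence \<open>e\<close> that does not depend on \<open>N\<close>.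
  Prepending an entry to the index changes \<open>e\<close> as follows: an entry 2 divides \<open>e\<close> by
  \<open>o\<^sup>2\<close>, while entries 1 and 3 add to the diagonal term twice a strict partial sum of \<open>e\<close>,
  because \<open>\<Sum>m>n. K N m * o\<^sub>m\<close> and \<open>\<Sum>m>n. (-1) ^ m * K N m\<close> have closed forms.
  As \<open>N\<close> grows, \<open>K N n\<close> tends to \<open>4 / pi\<close> by Wallis' product, boundedly in \<open>n\<close>, and
  Tannery's theorem turns the expansion into \<open>4 / pi * (\<Sum>n. e n)\<close>.
\<close>

definition od :: "nat \<Rightarrow> real" where
  "od k = 2 * real k - 1"

lemma od_ge_1: "1 \<le> k \<Longrightarrow> 1 \<le> od k"
  by (simp add: od_def)

lemma od_pos: "1 \<le> k \<Longrightarrow> 0 < od k"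
  by (simp add: od_def)


section \<open>Nested sums\<close>

text \<open>\<open>p k\<close> is the largest value allowed for the index after \<open>k\<close>:
  the identity gives the weakly decreasing tuples of star sums, the predecessor the strictly
  decreasing ones, so one recursion serves both.\<close>

fun nest :: "(nat \<Rightarrow> nat) \<Rightarrow> (nat \<Rightarrow> real) list \<Rightarrow> nat \<Rightarrow> real" where
  "nest p [] N = 1"
| "nest p (w # ws) N = (\<Sum>k=1..N. w k * nest p ws (p k))"

definition chain_lists :: "(nat \<Rightarrow> nat \<Rightarrow> bool) \<Rightarrow> nat \<Rightarrow> nat \<Rightarrow> nat list set" where
  "chain_lists R r N = {ks. length ks = r \<and> sorted_wrt R ks \<and> (\<forall>k\<in>set ks. 1 \<le> k \<and> k \<le> N)}"

lemma finite_chain_lists: "finite (chain_lists R r N)"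
proof -
  have "chain_lists R r N \<subseteq> {ks. set ks \<subseteq> {1..N} \<and> length ks = r}"
    by (auto simp: chain_lists_def)
  then show ?thesis
    using finite_lists_length_eq[of "{1..N}" r] finite_subset by blast
qed

lemma chain_lists_0: "chain_lists R 0 N = {[]}"
  by (auto simp: chain_lists_def)

text \<open>\<open>sorted_wrt\<close> compares the head with every later entry, so a head
  \<open>k\<close> confines the whole tail to values up to \<open>p k\<close>.\<close>

lemma chain_lists_Suc:
  assumes R: "\<And>k l. 1 \<le> k \<Longrightarrow> 1 \<le> l \<Longrightarrow> R k l \<longleftrightarrow> l \<le> p k" and p: "\<And>k. p k \<le> k"
  shows "chain_lists R (Suc r) N = (\<lambda>(k, ks). k # ks) ` (SIGMA k:{1..N}. chain_lists R r (p k))"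
proof (intro equalityI subsetI)
  fix ks assume ks: "ks \<in> chain_lists R (Suc r) N"
  then obtain k ls where kl: "ks = k # ls"
    by (cases ks) (auto simp: chain_lists_def)
  have "k \<in> {1..N}" "ls \<in> chain_lists R r (p k)"
    using ks R by (auto simp: chain_lists_def kl)
  then show "ks \<in> (\<lambda>(k, ks). k # ks) ` (SIGMA k:{1..N}. chain_lists R r (p k))"
    using kl by auto
next
  fix ks assume "ks \<in> (\<lambda>(k, ks). k # ks) ` (SIGMA k:{1..N}. chain_lists R r (p k))"
  then obtain k ls where kl: "ks = k # ls" "k \<in> {1..N}" "ls \<in> chain_lists R r (p k)"
    by auto
  have "R k l \<and> l \<le> N" if "l \<in> set ls" for l
    using that kl R[of k l] p[of k] by (force simp: chain_lists_def)
  then show "ks \<in> chain_lists R (Suc r) N"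
    using kl by (auto simp: chain_lists_def)
qed

lemma nest_eq_sum_chain_lists:
  assumes R: "\<And>k l. 1 \<le> k \<Longrightarrow> 1 \<le> l \<Longrightarrow> R k l \<longleftrightarrow> l \<le> p k" and p: "\<And>k. p k \<le> k"
  shows "nest p ws N = (\<Sum>ks\<in>chain_lists R (length ws) N. \<Prod>j<length ws. (ws ! j) (ks ! j))"
proof (induction ws arbitrary: N)
  case Nil
  then show ?case by (simp add: chain_lists_0)
next
  case (Cons w ws)
  have cs: "chain_lists R (Suc r) N = (\<lambda>(k, ks). k # ks) ` (SIGMA k:{1..N}. chain_lists R r (p k))" for r
    using R p by (rule chain_lists_Suc)
  have inj: "inj_on (\<lambda>(k, ks). k # ks) (SIGMA k:{1..N}. chain_lists R (length ws) (p k))"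
    by (auto simp: inj_on_def)
  have "(\<Sum>ks\<in>chain_lists R (length (w # ws)) N. \<Prod>j<length (w # ws). ((w # ws) ! j) (ks ! j))
      = (\<Sum>(k, ks)\<in>(SIGMA k:{1..N}. chain_lists R (length ws) (p k)).
           w k * (\<Prod>j<length ws. (ws ! j) (ks ! j)))"
    unfolding length_Cons cs
    by (subst sum.reindex[OF inj])
      (simp add: case_prod_unfold prod.lessThan_Suc_shift o_def del: prod.lessThan_Suc)
  also have "\<dots> = (\<Sum>k=1..N. \<Sum>ks\<in>chain_lists R (length ws) (p k).
           w k * (\<Prod>j<length ws. (ws ! j) (ks ! j)))"
    by (subst sum.Sigma) (auto simp: finite_chain_lists)
  also have "\<dots> = nest p (w # ws) N"
    by (simp add: Cons.IH sum_distrib_left)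
  finally show ?case ..
qed

text \<open>Every finite set of index tuples lies in some truncation. A bound on the truncated sums
  of absolute values therefore gives absolute summability, and the truncations form a cofinal
  sequence along which the unordered sum is reached.\<close>

lemma nest_tendsto_infsum:
  assumes R: "\<And>k l. 1 \<le> k \<Longrightarrow> 1 \<le> l \<Longrightarrow> R k l \<longleftrightarrow> l \<le> p k" and p: "\<And>k. p k \<le> k"
    and B: "\<And>N. nest p (map (\<lambda>w k. \<bar>w k\<bar>) ws) N \<le> B"
  shows "nest p ws \<longlonglongrightarrow> infsum (\<lambda>ks. \<Prod>j<length ws. (ws ! j) (ks ! j))
           {ks. length ks = length ws \<and> sorted_wrt R ks \<and> (\<forall>k\<in>set ks. 1 \<le> k)}"
    (is "_ \<longlonglongrightarrow> infsum ?f ?S")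
proof -
  have exh: "\<exists>N. F \<subseteq> chain_lists R (length ws) N" if F: "finite F" "F \<subseteq> ?S" for F
  proof -
    have "finite (\<Union>(set ` F))" using F by auto
    then obtain N where N: "\<forall>x\<in>\<Union>(set ` F). x \<le> N"
      using finite_nat_set_iff_bounded_le by blast
    have "F \<subseteq> chain_lists R (length ws) N"
      using F N by (fastforce simp: chain_lists_def)
    then show ?thesis ..
  qed
  have nest_eq: "nest p vs N = (\<Sum>ks\<in>chain_lists R (length vs) N. \<Prod>j<length vs. (vs ! j) (ks ! j))" for vs N
    using R p by (rule nest_eq_sum_chain_lists)
  have "(\<lambda>ks. norm (?f ks)) summable_on ?S"
  proof (rule nonneg_bdd_above_summable_on)
    show "bdd_above (sum (\<lambda>x. norm (?f x)) ` {F. F \<subseteq> ?S \<and> finite F})"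
    proof (rule bdd_aboveI2)
      fix F assume "F \<in> {F. F \<subseteq> ?S \<and> finite F}"
      then have "finite F" "F \<subseteq> ?S"
        by simp_all
      from exh[OF this] obtain N where N: "F \<subseteq> chain_lists R (length ws) N" ..
      have "(\<Sum>x\<in>F. norm (?f x)) \<le> (\<Sum>x\<in>chain_lists R (length ws) N. norm (?f x))"
        by (intro sum_mono2 finite_chain_lists N) auto
      also have "\<dots> = nest p (map (\<lambda>w k. \<bar>w k\<bar>) ws) N"
        by (simp add: nest_eq abs_prod)
      finally show "(\<Sum>x\<in>F. norm (?f x)) \<le> B"
        using B[of N] by simp
    qed
  qed auto
  then have "(?f has_sum infsum ?f ?S) ?S"
    by (rule has_sum_infsum[OF Infinite_Sum.abs_summable_summable])
  then have lim: "(sum ?f \<longlongrightarrow> infsum ?f ?S) (finite_subsets_at_top ?S)"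
    by (simp add: has_sum_def)
  have "filterlim (chain_lists R (length ws)) (finite_subsets_at_top ?S) sequentially"
    unfolding filterlim_finite_subsets_at_top
  proof (intro allI impI)
    fix X assume "finite X \<and> X \<subseteq> ?S"
    then obtain N where N: "X \<subseteq> chain_lists R (length ws) N"
      using exh[of X] by auto
    show "\<forall>\<^sub>F M in sequentially. finite (chain_lists R (length ws) M) \<and>
        X \<subseteq> chain_lists R (length ws) M \<and> chain_lists R (length ws) M \<subseteq> ?S"
      using eventually_ge_at_top[of N]
    proof eventually_elim
      case (elim M)
      have "chain_lists R (length ws) N \<subseteq> chain_lists R (length ws) M"
        using elim by (fastforce simp: chain_lists_def)
      then show ?case
        using N finite_chain_lists by (auto simp: chain_lists_def)
    qed
  qed
  from filterlim_compose[OF lim this] show ?thesis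
    by (simp add: nest_eq[abs_def])
qed

lemma nest_abs_eq:
  assumes "\<And>w k. w \<in> set ws \<Longrightarrow> 1 \<le> k \<Longrightarrow> 0 \<le> w k"
  shows "nest p (map (\<lambda>w k. \<bar>w k\<bar>) ws) N = nest p ws N"
  using assms by (induction ws arbitrary: N) (auto intro!: sum.cong)

lemma abs_nest_le: "\<bar>nest p ws N\<bar> \<le> nest p (map (\<lambda>w k. \<bar>w k\<bar>) ws) N"
proof (induction ws arbitrary: N)
  case (Cons w ws)
  have "\<bar>nest p (w # ws) N\<bar> \<le> (\<Sum>k=1..N. \<bar>w k\<bar> * \<bar>nest p ws (p k)\<bar>)"
    using sum_abs[of "\<lambda>k. w k * nest p ws (p k)" "{1..N}"] by (simp add: abs_mult)
  also have "\<dots> \<le> nest p (map (\<lambda>w k. \<bar>w k\<bar>) (w # ws)) N"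
    by (auto intro!: sum_mono mult_left_mono Cons.IH)
  finally show ?case .
qed auto

section \<open>Size estimates for nested sums\<close>

lemma sum_inverse_od_le: "(\<Sum>k=1..N. 1 / od k) \<le> 2 * sqrt (2 * real N + 1)"
proof (induction N)
  case (Suc N)
  define x where "x = 2 * real N + 1"
  have x: "x \<ge> 1" by (simp add: x_def)
  \<comment> \<open>The induction step amounts to
    \<open>sqrt x + 1 / (2 * x) \<le> sqrt (x + 2)\<close>, checked by squaring. Square-root growth
    is good enough, since at most two such factors will meet a weight
    \<open>1 / od k ^ 3\<close>.\<close>
  have "(sqrt x + 1 / (2 * x))\<^sup>2 = x + sqrt x / x + 1 / (4 * x\<^sup>2)"
    using x by (simp add: power2_eq_square field_simps)
  also have "\<dots> \<le> x + 1 + 1"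
  proof -
    have "sqrt x \<le> x" using x by (simp add: real_sqrt_le_iff real_le_lsqrt power2_eq_square)
    then have "sqrt x / x \<le> 1" using x by simp
    moreover have "1 \<le> 4 * x\<^sup>2" using one_le_power[OF x, of 2] by linarith
    then have "1 / (4 * x\<^sup>2) \<le> 1" by (intro divide_le_eq_1[THEN iffD2] disjI1 conjI) linarith+
    ultimately show ?thesis by linarith
  qed
  finally have "sqrt x + 1 / (2 * x) \<le> sqrt (x + 2)"
    by (simp add: real_le_rsqrt)
  moreover have "1 / (2 * x) = 1 / x / 2"
    by simp
  moreover have "(\<Sum>k=1..Suc N. 1 / od k) = (\<Sum>k=1..N. 1 / od k) + 1 / x"
    by (simp add: x_def od_def)
  moreover have y: "2 * real (Suc N) + 1 = x + 2"
    by (simp add: x_def)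
  ultimately show ?case
    using Suc unfolding y x_def[symmetric] by linarith
qed simp

lemma sum_inverse_od_sq_le: "(\<Sum>k=1..N. 1 / (od k)\<^sup>2) \<le> 2"
proof -
  \<comment> \<open>The subtracted term makes the induction close by telescoping.\<close>
  have "(\<Sum>k=1..Suc N. 1 / (od k)\<^sup>2) \<le> 2 - 1 / od (Suc N)" for N
  proof (induction N)
    case (Suc N)
    define x where "x = od (Suc N)"
    have x: "x \<ge> 1" "od (Suc (Suc N)) = x + 2" by (auto simp: x_def od_def)
    have "1 / (x + 2)\<^sup>2 \<le> 1 / x - 1 / (x + 2)"
      using x by (simp add: divide_simps power2_eq_square)
    then show ?case using Suc x by (simp add: x_def)
  qed (simp add: od_def)
  note * = this
  show ?thesis
  proof (cases N)
    case (Suc M)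
    then show ?thesis using *[of M] od_pos[of "Suc M"] by (smt (verit) One_nat_def le_add1 plus_1_eq_Suc zero_le_divide_1_iff)
  qed simp
qed

text \<open>Each level of nesting costs at most one factor from \<open>sum_inverse_od_le\<close>,
  because all inner truncations stay below \<open>N\<close>.\<close>

lemma nest_pred_le:
  assumes "\<And>w k. w \<in> set ws \<Longrightarrow> 1 \<le> k \<Longrightarrow> \<bar>w k\<bar> \<le> 1 / od k"
  shows "nest (\<lambda>k. k - 1) (map (\<lambda>w k. \<bar>w k\<bar>) ws) N \<le> (2 * sqrt (2 * real N + 1)) ^ length ws"
  using assms
proof (induction ws arbitrary: N)
  case (Cons w ws)
  have "\<bar>w k\<bar> * nest (\<lambda>k. k - 1) (map (\<lambda>w k. \<bar>w k\<bar>) ws) (k - 1)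
      \<le> 1 / od k * (2 * sqrt (2 * real N + 1)) ^ length ws" if k: "k \<in> {1..N}" for k
  proof (rule mult_mono)
    have "nest (\<lambda>k. k - 1) (map (\<lambda>w k. \<bar>w k\<bar>) ws) (k - 1) \<le> (2 * sqrt (2 * real (k - 1) + 1)) ^ length ws"
      using Cons by simp
    also have "\<dots> \<le> (2 * sqrt (2 * real N + 1)) ^ length ws"
      using k by (intro power_mono) auto
    finally show "nest (\<lambda>k. k - 1) (map (\<lambda>w k. \<bar>w k\<bar>) ws) (k - 1) \<le> (2 * sqrt (2 * real N + 1)) ^ length ws" .
    show "0 \<le> nest (\<lambda>k. k - 1) (map (\<lambda>w k. \<bar>w k\<bar>) ws) (k - 1)"
      using abs_nest_le[of "\<lambda>k. k - 1" ws "k - 1"] by linarith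
  qed (use k Cons.prems od_pos[of k] in auto)
  then have "nest (\<lambda>k. k - 1) (map (\<lambda>w k. \<bar>w k\<bar>) (w # ws)) N
      \<le> (\<Sum>k=1..N. 1 / od k * (2 * sqrt (2 * real N + 1)) ^ length ws)"
    by (auto intro!: sum_mono)
  also have "\<dots> = (\<Sum>k=1..N. 1 / od k) * (2 * sqrt (2 * real N + 1)) ^ length ws"
    by (simp add: sum_distrib_right)
  also have "\<dots> \<le> 2 * sqrt (2 * real N + 1) * (2 * sqrt (2 * real N + 1)) ^ length ws"
    by (intro mult_right_mono sum_inverse_od_le) auto
  finally show ?case by simp
qed auto

text \<open>Truncating at \<open>k - 1\<close> makes the square root exactly
  \<open>sqrt (od k)\<close>. Two levels then cost \<open>4 * od k\<close>, and the cubic decay of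
  \<open>v\<close> still leaves a summable majorant.\<close>

lemma nest_pred_term_le:
  assumes "\<And>w k. w \<in> set ws \<Longrightarrow> 1 \<le> k \<Longrightarrow> \<bar>w k\<bar> \<le> 1 / od k"
    and "length ws \<le> 2" and "1 \<le> k" and v: "\<bar>v\<bar> \<le> 1 / od k ^ 3"
  shows "\<bar>v\<bar> * nest (\<lambda>k. k - 1) (map (\<lambda>w k. \<bar>w k\<bar>) ws) (k - 1) \<le> 4 / (od k)\<^sup>2"
proof -
  have o: "od k \<ge> 1" "2 * real (k - 1) + 1 = od k"
    using \<open>1 \<le> k\<close> by (auto simp: od_def)
  have "nest (\<lambda>k. k - 1) (map (\<lambda>w k. \<bar>w k\<bar>) ws) (k - 1) \<le> (2 * sqrt (od k)) ^ length ws"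
    using nest_pred_le[of ws "k - 1"] assms o by simp
  also have "\<dots> \<le> (2 * sqrt (od k)) ^ 2"
  proof (rule power_increasing[OF assms(2)])
    have "1 \<le> sqrt (od k)" using o by simp
    then show "1 \<le> 2 * sqrt (od k)" by linarith
  qed
  also have "\<dots> = 4 * od k"
    using o by (simp add: power_mult_distrib)
  finally have "\<bar>v\<bar> * nest (\<lambda>k. k - 1) (map (\<lambda>w k. \<bar>w k\<bar>) ws) (k - 1) \<le> 1 / od k ^ 3 * (4 * od k)"
    using v o abs_nest_le[of "\<lambda>k. k - 1" ws "k - 1"] by (intro mult_mono) auto
  also have "\<dots> = 4 / (od k)\<^sup>2"
    using o by (simp add: field_simps power2_eq_square power3_eq_cube)
  finally show ?thesis .
qed


section \<open>The kernel\<close>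

text \<open>The factorials arise from \<open>o_k^2 - o_n^2 = 4 (k - n) (k + n - 1)\<close>
  multiplied over \<open>k \<noteq> n\<close>, the numerator from
  \<open>(k - 1/2)^2 = o_k^2 / 4\<close>. The value 0 beyond \<open>N\<close> lets sums over
  different ranges be compared.\<close>

definition K :: "nat \<Rightarrow> nat \<Rightarrow> real" where
  "K N n = (if n \<le> N then 4 * (\<Prod>k=1..N. (real k - 1/2)\<^sup>2) / (fact (N - n) * fact (N + n - 1)) else 0)"

lemma K_nonneg: "0 \<le> K N n"
  by (simp add: K_def prod_nonneg)

lemma K_eq_0: "N < n \<Longrightarrow> K N n = 0"
  by (simp add: K_def)

text \<open>Quotient of neighbouring factorials. The multiplied-out form also covers
  \<open>n \<ge> N\<close>, where both sides vanish.\<close>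

lemma K_Suc_right:
  assumes "1 \<le> n"
  shows "K N (Suc n) * (real N + real n) = K N n * (real N - real n)"
proof (cases "n < N")
  case True
  then obtain d where d: "N = Suc (n + d)"
    using less_imp_Suc_add by blast
  obtain m where m: "n = Suc m" using assms by (cases n) auto
  have "fact (N - n) = (real N - real n) * fact (N - Suc n)"
    using d by simp
  moreover have "fact (N + Suc n - 1) = (real N + real n) * fact (N + n - 1)"
    using m by simp
  ultimately show ?thesis
    using True unfolding K_def by (simp add: divide_simps)
next
  case False
  then show ?thesis by (cases "n = N") (auto simp: K_def)
qed

text \<open>The new factors \<open>4 * (N + 1 - n) * (N + n)\<close> form a difference of odd
  squares. Solved for the increment this reads
  \<open>K (Suc N) n - K N n = K (Suc N) n * (od n / od (Suc N))^2\<close>, the form that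
  \<open>K_step\<close> exploits.\<close>

lemma K_Suc_left:
  assumes "1 \<le> n" "n \<le> Suc N"
  shows "K N n * (od (Suc N))\<^sup>2 = K (Suc N) n * ((od (Suc N))\<^sup>2 - (od n)\<^sup>2)"
proof (cases "n \<le> N")
  case True
  obtain d where d: "N = n + d" using True le_iff_add by blast
  obtain m where m: "n = Suc m" using assms by (cases n) auto
  define P where "P = (\<Prod>k=1..N. (real k - 1/2)\<^sup>2)"
  define u where "u = real N + 1 - real n"
  define v where "v = real N + real n"
  define F :: real where "F = fact (N - n)"
  define G :: real where "G = fact (N + n - 1)"
  have f: "fact (Suc N - n) = u * F" "fact (Suc N + n - 1) = v * G"
    using d m by (simp_all add: u_def v_def F_def G_def)
  have "u > 0" "v > 0" "F > 0" "G > 0"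
    using True m by (auto simp: u_def v_def F_def G_def)
  moreover have "K N n = 4 * P / (F * G)"
    using True by (simp add: K_def P_def F_def G_def)
  moreover have "K (Suc N) n = 4 * (P * (real N + 1/2)\<^sup>2) / ((u * F) * (v * G))"
    using True f by (simp add: K_def P_def)
  moreover have "(od (Suc N))\<^sup>2 - (od n)\<^sup>2 = 4 * u * v"
    by (simp add: od_def u_def v_def power2_eq_square algebra_simps)
  moreover have "(od (Suc N))\<^sup>2 = 4 * (real N + 1/2)\<^sup>2"
    by (simp add: od_def power2_eq_square algebra_simps)
  ultimately show ?thesis
    by simp
next
  case False
  then have "n = Suc N" using assms by simp
  then show ?thesis by (simp add: K_eq_0)
qed

text \<open>Downward induction from \<open>n = N\<close>: adding the term \<open>m = Suc i\<close>
  yields \<open>2 * K N (Suc i) * (N + i)\<close>, which \<open>K_Suc_right\<close> converts into a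
  multiple of \<open>K N i\<close>.\<close>

lemma sum_K_od:
  assumes "1 \<le> n" "n \<le> N"
  shows "2 * (\<Sum>m=Suc n..N. K N m * od m) = K N n * (od N - od n)"
  using assms(2)
proof (induction rule: inc_induct)
  case (step i)
  have "(\<Sum>m=Suc i..N. K N m * od m) = K N (Suc i) * od (Suc i) + (\<Sum>m=Suc (Suc i)..N. K N m * od m)"
    using step by (intro sum.atLeast_Suc_atMost) auto
  then have "2 * (\<Sum>m=Suc i..N. K N m * od m) = 2 * (K N (Suc i) * (real N + real i))"
    using step by (simp add: od_def algebra_simps)
  also have "\<dots> = K N i * (od N - od i)"
    using step assms by (subst K_Suc_right) (auto simp: od_def algebra_simps)
  finally show ?case .
qed simp

text \<open>Again downward induction with \<open>K_Suc_right\<close>. The combination of diagonal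
  term and doubled tail is the one that an index entry 3 produces.\<close>

lemma sum_K_alternating:
  assumes "1 \<le> n" "n \<le> N"
  shows "od N * (K N n + 2 * (\<Sum>m=Suc n..N. (-1) ^ (m + n) * K N m)) = od n * K N n"
  using assms(2)
proof (induction rule: inc_induct)
  case (step i)
  define S where "S = (\<Sum>m=Suc (Suc i)..N. (-1) ^ (m + Suc i) * K N m)"
  have IH: "od N * (K N (Suc i) + 2 * S) = od (Suc i) * K N (Suc i)"
    using step by (simp add: S_def)
  have "(\<Sum>m=Suc i..N. (-1) ^ (m + i) * K N m) =
      (-1) ^ (Suc i + i) * K N (Suc i) + (\<Sum>m=Suc (Suc i)..N. (-1) ^ (m + i) * K N m)"
    using step by (intro sum.atLeast_Suc_atMost) auto
  also have "(\<Sum>m=Suc (Suc i)..N. (-1) ^ (m + i) * K N m) = - S"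
    by (simp add: S_def sum_negf)
  finally have T: "(\<Sum>m=Suc i..N. (-1) ^ (m + i) * K N m) = - K N (Suc i) - S"
    by simp
  have "K N (Suc i) * (real N + real i) = K N i * (real N - real i)"
    using step assms by (intro K_Suc_right) auto
  then show ?case
    unfolding T using IH by (simp add: od_def algebra_simps)
qed simp

text \<open>The upper limit \<open>n\<close> is kept free so that induction can run on it. At
  \<open>n = N\<close> the right-hand side vanishes, hence the full alternating sum is 0 for
  \<open>N \<ge> 2\<close>.\<close>

lemma sum_K_sign_od:
  assumes "1 \<le> n"
  shows "(real N - 1) * (\<Sum>m=1..n. (-1) ^ (m + 1) * K N m * od m) = (-1) ^ (n + 1) * K N n * real n * (real N - real n)"
  using assms
proof (induction rule: dec_induct)
  case (step n)
  have "(real N - 1) * (\<Sum>m=1..Suc n. (-1) ^ (m + 1) * K N m * od m)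
     = (-1) ^ (n + 1) * (K N n * (real N - real n)) * real n - (-1) ^ (n + 1) * K N (Suc n) * od (Suc n) * (real N - 1)"
    using step by (simp add: algebra_simps)
  also have "K N n * (real N - real n) = K N (Suc n) * (real N + real n)"
    using step by (subst K_Suc_right) auto
  finally show ?case
    by (simp add: od_def algebra_simps)
qed (simp add: od_def)

text \<open>By \<open>K_Suc_left\<close>, passing from \<open>N\<close> to \<open>Suc N\<close>
  changes the right-hand side by the sum weighted with squares of \<open>od n\<close>, divided by
  the square of \<open>od (Suc N)\<close>. The hypothesis says that this is the new term on the
  left.\<close>

lemma K_step:
  assumes h: "\<And>M. 1 \<le> M \<Longrightarrow> od M ^ x * (\<Sum>n=1..M. K M n * (od n)\<^sup>2 * h n) = (od M)\<^sup>2 * g M"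
  shows "(\<Sum>k=1..N. 1 / od k ^ x * g k) = (\<Sum>n=1..N. K N n * h n)"
proof (induction N)
  case (Suc N)
  let ?o = "od (Suc N)"
  have o: "?o > 0" by (simp add: od_def)
  \<comment> \<open>The extra term is zero, since \<open>K N (Suc N) = 0\<close>.\<close>
  have "(\<Sum>n=1..N. K N n * h n) = (\<Sum>n=1..Suc N. K N n * h n)"
    by (simp add: K_eq_0)
  also have "\<dots> = (\<Sum>n=1..Suc N. K (Suc N) n * h n - K (Suc N) n * (od n)\<^sup>2 * h n / ?o\<^sup>2)"
  proof (rule sum.cong)
    fix n assume n: "n \<in> {1..Suc N}"
    have "K N n = K (Suc N) n - K (Suc N) n * (od n)\<^sup>2 / ?o\<^sup>2"
      using K_Suc_left[of n N] n o by (simp add: field_simps)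
    then show "K N n * h n = K (Suc N) n * h n - K (Suc N) n * (od n)\<^sup>2 * h n / ?o\<^sup>2"
      by (simp add: left_diff_distrib)
  qed simp
  also have "\<dots> = (\<Sum>n=1..Suc N. K (Suc N) n * h n) - (\<Sum>n=1..Suc N. K (Suc N) n * (od n)\<^sup>2 * h n) / ?o\<^sup>2"
    by (simp only: sum_subtractf sum_divide_distrib)
  also have "(\<Sum>n=1..Suc N. K (Suc N) n * (od n)\<^sup>2 * h n) / ?o\<^sup>2 = 1 / ?o ^ x * g (Suc N)"
    using h[of "Suc N"] o by (simp add: field_simps del: sum.cl_ivl_Suc)
  finally have "(\<Sum>n=1..N. K N n * h n) = (\<Sum>n=1..Suc N. K (Suc N) n * h n) - 1 / ?o ^ x * g (Suc N)" .
  moreover have "(\<Sum>k=1..Suc N. 1 / od k ^ x * g k) = (\<Sum>k=1..N. 1 / od k ^ x * g k) + 1 / ?o ^ x * g (Suc N)"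
    by simp
  ultimately show ?case using Suc by linarith
qed simp

text \<open>This is the partial fraction decomposition at \<open>x = 0\<close>. It follows from
  \<open>K_step\<close> with exponent 0 and \<open>g\<close> the indicator of 1, because the
  alternating sums vanish for \<open>M > 1\<close>.\<close>

lemma sum_K_sign:
  assumes "1 \<le> N"
  shows "(\<Sum>n=1..N. K N n * ((-1) ^ (n + 1) / od n)) = 1"
proof -
  have eq: "od M ^ 0 * (\<Sum>n=1..M. K M n * (od n)\<^sup>2 * ((-1) ^ (n + 1) / od n)) = (od M)\<^sup>2 * (if M = 1 then 1 else 0)"
    if "1 \<le> M" for M
  proof -
    have "(\<Sum>n=1..M. K M n * (od n)\<^sup>2 * ((-1) ^ (n + 1) / od n)) = (\<Sum>m=1..M. (-1) ^ (m + 1) * K M m * od m)"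
      using od_pos by (intro sum.cong) (auto simp: power2_eq_square order_less_imp_not_eq2)
    also have "\<dots> = (if M = 1 then 1 else 0)"
    proof (cases "M = 1")
      case True
      then show ?thesis by (simp add: K_def od_def power2_eq_square)
    next
      case False
      then show ?thesis using sum_K_sign_od[of M M] that by simp
    qed
    finally show ?thesis by (simp add: od_def)
  qed
  have "(\<Sum>n=1..N. K N n * ((-1) ^ (n + 1) / od n)) = (\<Sum>k=1..N. 1 / od k ^ 0 * (if k = 1 then 1 else 0))"
    using K_step[of 0, OF eq] by simp
  then show ?thesis using assms by simp
qed

section \<open>Wallis limit and boundedness of the kernel\<close>

lemma K_1_wallis:
  "K (Suc N) 1 * (\<Prod>k=1..N. (4 * real k ^ 2) / (4 * real k ^ 2 - 1)) = (2 * real N + 1) / (real N + 1)"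
proof (induction N)
  case 0
  then show ?case by (simp add: K_def power2_eq_square)
next
  case (Suc N)
  define P where "P = (\<Prod>k=1..N. (4 * real k ^ 2) / (4 * real k ^ 2 - 1))"
  define x where "x = real N"
  have x: "x \<ge> 0" by (simp add: x_def)
  \<comment> \<open>The recurrence in \<open>N\<close> at \<open>n = 1\<close>, where
    \<open>(2 * x + 3)^2 - 1 = 4 * (x + 1) * (x + 2)\<close>.\<close>
  have "K (Suc N) 1 * (2 * x + 3)\<^sup>2 = K (Suc (Suc N)) 1 * (4 * (x + 1) * (x + 2))"
    using K_Suc_left[of 1 "Suc N"] by (simp add: od_def x_def power2_eq_square algebra_simps)
  then have 1: "K (Suc (Suc N)) 1 = K (Suc N) 1 * (2 * x + 3)\<^sup>2 / (4 * (x + 1) * (x + 2))"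
    using x by (subst nonzero_eq_divide_eq) auto
  have 2: "4 * (x + 1)\<^sup>2 - 1 = (2 * x + 1) * (2 * x + 3)"
    by (simp add: power2_eq_square algebra_simps)
  have "K (Suc (Suc N)) 1 * (P * (4 * (x + 1)\<^sup>2 / (4 * (x + 1)\<^sup>2 - 1)))
      = (K (Suc N) 1 * P) * ((2 * x + 3)\<^sup>2 / (4 * (x + 1) * (x + 2)) * (4 * (x + 1)\<^sup>2 / ((2 * x + 1) * (2 * x + 3))))"
    unfolding 1 2 by simp
  also have "K (Suc N) 1 * P = (2 * x + 1) / (x + 1)"
    using Suc by (simp add: P_def x_def)
  also have "\<dots> * ((2 * x + 3)\<^sup>2 / (4 * (x + 1) * (x + 2)) * (4 * (x + 1)\<^sup>2 / ((2 * x + 1) * (2 * x + 3))))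
      = (2 * x + 3) / (x + 2)"
    using x by (simp add: divide_simps power2_eq_square)
  finally show ?case
    by (simp add: P_def x_def add.commute)
qed

text \<open>For \<open>n = 1\<close> the Wallis product tends to \<open>pi / 2\<close> and the
  right-hand side of \<open>K_1_wallis\<close> to 2, so the quotient is \<open>4 / pi\<close>. Each
  further \<open>n\<close> multiplies by \<open>(N - n) / (N + n)\<close>, which tends to 1.\<close>

lemma K_tendsto:
  assumes "1 \<le> n"
  shows "(\<lambda>N. K N n) \<longlonglongrightarrow> 4 / pi"
  using assms
proof (induction rule: dec_induct)
  case base
  define P where "P = (\<lambda>N. \<Prod>k=1..N. (4 * real k ^ 2) / (4 * real k ^ 2 - 1))"
  have P: "P \<longlonglongrightarrow> pi / 2" unfolding P_def by (rule wallis)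
  have "P N \<noteq> 0" for N
  proof -
    have "0 < 4 * (real k)\<^sup>2 - 1" if "1 \<le> k" for k
    proof -
      have "1 \<le> (real k)\<^sup>2" using that by (intro one_le_power) auto
      then show ?thesis by linarith
    qed
    then show ?thesis unfolding P_def by (force intro!: prod_pos dest: less_imp_neq)
  qed
  moreover have "K (Suc N) 1 * P N = (2 * real N + 1) / (real N + 1)" for N
    unfolding P_def by (rule K_1_wallis)
  ultimately have "K (Suc N) 1 = (2 * real N + 1) / (real N + 1) / P N" for N
    by (metis nonzero_eq_divide_eq)
  moreover have "(\<lambda>N. (2 * real N + 1) / (real N + 1)) \<longlonglongrightarrow> 2"
  proof -
    have "(\<lambda>N. 2 - inverse (real (Suc N))) \<longlonglongrightarrow> 2 - 0"
      by (intro tendsto_intros LIMSEQ_inverse_real_of_nat)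
    then show ?thesis by (simp add: field_simps)
  qed
  ultimately have "(\<lambda>N. K (Suc N) 1) \<longlonglongrightarrow> 2 / (pi / 2)"
    using tendsto_divide[OF _ P, of "\<lambda>N. (2 * real N + 1) / (real N + 1)" 2] by simp
  then show ?case using LIMSEQ_imp_Suc by force
next
  case (step n)
  have "(\<lambda>N. (real N - real n) / (real N + real n)) \<longlonglongrightarrow> 1"
  proof -
    have "filterlim (\<lambda>N. real N + real n) at_infinity sequentially"
      using filterlim_tendsto_add_at_top[OF tendsto_const filterlim_real_sequentially, of "real n"]
      by (intro filterlim_at_top_imp_at_infinity) (simp add: add.commute)
    then have "(\<lambda>N. 1 - 2 * real n / (real N + real n)) \<longlonglongrightarrow> 1 - 0"
      by (intro tendsto_diff tendsto_const tendsto_divide_0[OF tendsto_const])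
    then show ?thesis using step by (simp add: field_simps)
  qed
  then have "(\<lambda>N. K N n * ((real N - real n) / (real N + real n))) \<longlonglongrightarrow> 4 / pi * 1"
    by (intro tendsto_mult step)
  moreover have "K N n * ((real N - real n) / (real N + real n)) = K N (Suc n)" for N
    using K_Suc_right[of n N] step by (simp add: field_simps)
  ultimately show ?case by simp
qed

text \<open>For fixed \<open>N\<close> the kernel is nonincreasing in \<open>n \<ge> 1\<close>, and
  \<open>K N 1\<close> converges as \<open>N\<close> grows, so one bound works for all
  pairs.\<close>

lemma K_bounded: obtains B where "0 \<le> B" "\<And>N n. 1 \<le> n \<Longrightarrow> K N n \<le> B"
proof -
  have "Bseq (\<lambda>N. K N 1)"
    using K_tendsto[of 1] by (intro convergent_imp_Bseq convergentI) auto
  then obtain B where B: "B > 0" "\<And>N. \<bar>K N 1\<bar> \<le> B"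
    by (auto simp: Bseq_def)
  have "K N n \<le> B" if "1 \<le> n" for N n
    using that
  proof (induction rule: dec_induct)
    case base
    then show ?case using B(2)[of N] by simp
  next
    case (step n)
    have "K N (Suc n) * (real N + real n) \<le> K N n * (real N + real n)"
      using K_Suc_right[of n N] step K_nonneg[of N n] by (simp add: mult_left_mono)
    then have "K N (Suc n) \<le> K N n" using step by (simp add: mult_le_cancel_right)
    then show ?case using step by linarith
  qed
  then show ?thesis using that B by (meson less_imp_le)
qed


section \<open>Kernel expansions of truncated star sums\<close>

definition star_sum :: "nat list \<Rightarrow> nat \<Rightarrow> real" where
  "star_sum s = nest (\<lambda>k. k) (map (\<lambda>x k. 1 / od k ^ x) s)"

text \<open>\<open>N = 0\<close> is excluded because the empty index has the value 1 there, while
  the right-hand side is an empty sum.\<close>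

definition expands :: "nat list \<Rightarrow> (nat \<Rightarrow> real) \<Rightarrow> bool" where
  "expands s e \<longleftrightarrow> (\<forall>N\<ge>1. star_sum s N = (\<Sum>n=1..N. K N n * e n))"

lemma expands_Nil: "expands [] (\<lambda>n. (-1) ^ (n + 1) / od n)"
  using sum_K_sign by (auto simp: expands_def star_sum_def)

lemma expands_Cons:
  assumes "expands s e"
    and "\<And>M. 1 \<le> M \<Longrightarrow> od M ^ x * (\<Sum>n=1..M. K M n * (od n)\<^sup>2 * h n) = (od M)\<^sup>2 * (\<Sum>n=1..M. K M n * e n)"
  shows "expands (x # s) h"
  unfolding expands_def
proof (intro allI impI)
  fix N :: nat assume "1 \<le> N"
  have "star_sum (x # s) N = (\<Sum>k=1..N. 1 / od k ^ x * star_sum s k)"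
    by (simp add: star_sum_def)
  also have "\<dots> = (\<Sum>n=1..N. K N n * h n)"
    using assms by (intro K_step) (auto simp: expands_def)
  finally show "star_sum (x # s) N = (\<Sum>n=1..N. K N n * h n)" .
qed

lemma expands_2:
  assumes "expands s e"
  shows "expands (2 # s) (\<lambda>n. e n / (od n)\<^sup>2)"
proof (rule expands_Cons[OF assms])
  fix M
  have "(\<Sum>n=1..M. K M n * (od n)\<^sup>2 * (e n / (od n)\<^sup>2)) = (\<Sum>n=1..M. K M n * e n)"
    using od_pos by (intro sum.cong) (auto simp: order_less_imp_not_eq2)
  then show "(od M)\<^sup>2 * (\<Sum>n=1..M. K M n * (od n)\<^sup>2 * (e n / (od n)\<^sup>2)) = (od M)\<^sup>2 * (\<Sum>n=1..M. K M n * e n)"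
    by simp
qed

lemma expands_replicate_2:
  assumes "expands s e"
  shows "expands (replicate a 2 @ s) (\<lambda>n. e n / od n ^ (2 * a))"
proof (induction a)
  case (Suc a)
  then show ?case using expands_2[OF Suc]
    by (simp add: power2_eq_square mult.assoc mult.commute mult.left_commute)
qed (use assms in simp)

lemma sum_triangle_swap:
  fixes f :: "nat \<Rightarrow> nat \<Rightarrow> real"
  shows "(\<Sum>m=1..M. \<Sum>n=1..m - 1. f m n) = (\<Sum>n=1..M. \<Sum>m=Suc n..M. f m n)"
proof -
  have "(\<Sum>m=1..M. \<Sum>n=1..m - 1. f m n) = (\<Sum>m=1..M. \<Sum>n\<in>{n. n \<in> {1..M} \<and> n < m}. f m n)"
    by (intro sum.cong) auto
  also have "\<dots> = (\<Sum>n=1..M. \<Sum>m\<in>{m. m \<in> {1..M} \<and> n < m}. f m n)"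
    by (rule sum.swap_restrict) auto
  also have "\<dots> = (\<Sum>n=1..M. \<Sum>m=Suc n..M. f m n)"
    by (intro sum.cong) auto
  finally show ?thesis .
qed

text \<open>After the two summations are exchanged, the diagonal contributes \<open>od n\<close> and
  the tail, by \<open>sum_K_od\<close>, \<open>od M - od n\<close>. Their total \<open>od M\<close>
  is independent of \<open>n\<close> and factors out.\<close>

lemma expands_1:
  assumes "expands s e"
  shows "expands (1 # s) (\<lambda>m. (e m + 2 * (\<Sum>n=1..m - 1. e n)) / od m)"
proof (rule expands_Cons[OF assms])
  fix M :: nat assume "1 \<le> M"
  have "(\<Sum>m=1..M. K M m * (od m)\<^sup>2 * ((e m + 2 * (\<Sum>n=1..m - 1. e n)) / od m))
      = (\<Sum>m=1..M. K M m * od m * e m + (\<Sum>n=1..m - 1. 2 * K M m * od m * e n))"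
  proof (rule sum.cong)
    fix m assume "m \<in> {1..M}"
    then have "K M m * (od m)\<^sup>2 * ((e m + 2 * S) / od m) = K M m * od m * e m + 2 * K M m * od m * S" for S
      using od_pos[of m] by (simp add: power2_eq_square field_simps)
    then show "K M m * (od m)\<^sup>2 * ((e m + 2 * (\<Sum>n=1..m - 1. e n)) / od m)
        = K M m * od m * e m + (\<Sum>n=1..m - 1. 2 * K M m * od m * e n)"
      by (simp only: sum_distrib_left[of "2 * K M m * od m", symmetric])
  qed simp
  also have "\<dots> = (\<Sum>n=1..M. K M n * od n * e n + (\<Sum>m=Suc n..M. 2 * K M m * od m * e n))"
    by (simp only: sum.distrib sum_triangle_swap)
  also have "\<dots> = (\<Sum>n=1..M. od M * (K M n * e n))"
  proof (rule sum.cong)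
    fix n assume n: "n \<in> {1..M}"
    have "(\<Sum>m=Suc n..M. 2 * K M m * od m * e n) = 2 * (\<Sum>m=Suc n..M. K M m * od m) * e n"
      by (simp add: sum_distrib_left sum_distrib_right mult.assoc)
    also have "\<dots> = K M n * (od M - od n) * e n"
      using n by (subst sum_K_od) auto
    finally show "K M n * od n * e n + (\<Sum>m=Suc n..M. 2 * K M m * od m * e n) = od M * (K M n * e n)"
      by (simp add: algebra_simps)
  qed simp
  also have "\<dots> = od M * (\<Sum>n=1..M. K M n * e n)"
    by (simp add: sum_distrib_left)
  finally show "od M ^ 1 * (\<Sum>m=1..M. K M m * (od m)\<^sup>2 * ((e m + 2 * (\<Sum>n=1..m - 1. e n)) / od m))
      = (od M)\<^sup>2 * (\<Sum>n=1..M. K M n * e n)"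
    by (simp add: power2_eq_square)
qed

text \<open>The same exchange; now diagonal and alternating tail combine by
  \<open>sum_K_alternating\<close> to the factor \<open>od n / od M\<close>. Here
  \<open>od n\<close> cancels the division in \<open>e n / od n\<close>, and \<open>1 / od M\<close>
  lowers the cube of \<open>od M\<close> to a square.\<close>

lemma expands_3:
  assumes "expands s e"
  shows "expands (3 # s) (\<lambda>m. (e m / od m + 2 * (\<Sum>n=1..m - 1. (-1) ^ (m + n) * (e n / od n))) / (od m)\<^sup>2)"
proof (rule expands_Cons[OF assms])
  fix M :: nat assume M: "1 \<le> M"
  let ?h = "\<lambda>m. (e m / od m + 2 * (\<Sum>n=1..m - 1. (-1) ^ (m + n) * (e n / od n))) / (od m)\<^sup>2"
  have "(\<Sum>m=1..M. K M m * (od m)\<^sup>2 * ?h m)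
      = (\<Sum>m=1..M. K M m * (e m / od m) + (\<Sum>n=1..m - 1. 2 * K M m * ((-1) ^ (m + n) * (e n / od n))))"
  proof (rule sum.cong)
    fix m assume "m \<in> {1..M}"
    then have "K M m * (od m)\<^sup>2 * ((e m / od m + 2 * S) / (od m)\<^sup>2) = K M m * (e m / od m) + 2 * K M m * S" for S
      using od_pos[of m] by (simp add: field_simps)
    then show "K M m * (od m)\<^sup>2 * ?h m
        = K M m * (e m / od m) + (\<Sum>n=1..m - 1. 2 * K M m * ((-1) ^ (m + n) * (e n / od n)))"
      by (simp only: sum_distrib_left[of "2 * K M m", symmetric])
  qed simp
  also have "\<dots> = (\<Sum>n=1..M. K M n * (e n / od n) + (\<Sum>m=Suc n..M. 2 * K M m * ((-1) ^ (m + n) * (e n / od n))))"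
    by (simp only: sum.distrib sum_triangle_swap)
  also have "\<dots> = (\<Sum>n=1..M. K M n * e n / od M)"
  proof (rule sum.cong)
    fix n assume n: "n \<in> {1..M}"
    have "K M n * q + (\<Sum>m=Suc n..M. 2 * K M m * ((-1) ^ (m + n) * q))
        = (K M n + 2 * (\<Sum>m=Suc n..M. (-1) ^ (m + n) * K M m)) * q" for q
      by (simp add: sum_distrib_left sum_distrib_right algebra_simps)
    then have "K M n * (e n / od n) + (\<Sum>m=Suc n..M. 2 * K M m * ((-1) ^ (m + n) * (e n / od n)))
        = (K M n + 2 * (\<Sum>m=Suc n..M. (-1) ^ (m + n) * K M m)) * (e n / od n)" .
    also have "K M n + 2 * (\<Sum>m=Suc n..M. (-1) ^ (m + n) * K M m) = od n * K M n / od M"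
      using sum_K_alternating[of n M] n od_pos[OF M] by (simp add: field_simps)
    finally show "K M n * (e n / od n) + (\<Sum>m=Suc n..M. 2 * K M m * ((-1) ^ (m + n) * (e n / od n))) = K M n * e n / od M"
      using n od_pos[of n] by simp
  qed simp
  also have "\<dots> = (\<Sum>n=1..M. K M n * e n) / od M"
    by (simp add: sum_divide_distrib)
  finally show "od M ^ 3 * (\<Sum>m=1..M. K M m * (od m)\<^sup>2 * ?h m) = (od M)\<^sup>2 * (\<Sum>n=1..M. K M n * e n)"
    using od_pos[OF M] by (simp add: power2_eq_square power3_eq_cube)
qed

section \<open>Passage to the limit\<close>

lemma expands_tendsto:
  assumes e: "expands s e" and C: "\<And>n. 1 \<le> n \<Longrightarrow> \<bar>e n\<bar> \<le> C / (od n)\<^sup>2"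
    and L: "(\<lambda>N. \<Sum>n=1..N. e n) \<longlonglongrightarrow> L"
  shows "star_sum s \<longlonglongrightarrow> 4 / pi * L"
proof -
  obtain B where B: "0 \<le> B" "\<And>N n. 1 \<le> n \<Longrightarrow> K N n \<le> B"
    using K_bounded by blast
  have "summable (\<lambda>k. 1 / (od (Suc k))\<^sup>2)"
  proof (rule bounded_imp_summable)
    fix n
    have "(\<Sum>k\<le>n. 1 / (od (Suc k))\<^sup>2) = (\<Sum>k=1..Suc n. 1 / (od k)\<^sup>2)"
      by (rule sum.reindex_bij_witness[of _ "\<lambda>k. k - 1" Suc]) auto
    then show "(\<Sum>k\<le>n. 1 / (od (Suc k))\<^sup>2) \<le> 2"
      using sum_inverse_od_sq_le[of "Suc n"] by simp
  qed simp
  then have M: "summable (\<lambda>k. B * C * (1 / (od (Suc k))\<^sup>2))"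
    by (rule summable_mult)
  \<comment> \<open>The bound \<open>B\<close> on the kernel and the decay of \<open>e\<close> give
    a summable majorant independent of \<open>N\<close>. The shift by \<open>Suc\<close> reconciles
    series starting at 0 with sums starting at 1.\<close>
  have "(\<lambda>N. \<Sum>k. K N (Suc k) * e (Suc k)) \<longlonglongrightarrow> (\<Sum>k. 4 / pi * e (Suc k))"
  proof (rule tannerys_theorem[THEN conjunct2, THEN conjunct2, OF _ _ M])
    have "norm (K N (Suc k) * e (Suc k)) \<le> B * C * (1 / (od (Suc k))\<^sup>2)" for k N
    proof -
      have "norm (K N (Suc k) * e (Suc k)) \<le> B * (C / (od (Suc k))\<^sup>2)"
        unfolding norm_mult using B C[of "Suc k"] K_nonneg[of N "Suc k"] by (intro mult_mono) auto
      then show ?thesis by simp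
    qed
    then show "\<forall>\<^sub>F (k, N) in sequentially \<times>\<^sub>F sequentially. norm (K N (Suc k) * e (Suc k)) \<le> B * C * (1 / (od (Suc k))\<^sup>2)"
      by (intro always_eventually) auto
    show "(\<lambda>N. K N (Suc k) * e (Suc k)) \<longlonglongrightarrow> 4 / pi * e (Suc k)" for k
      by (intro tendsto_mult tendsto_const K_tendsto) simp
  qed simp
  moreover have "(\<Sum>k. K N (Suc k) * e (Suc k)) = (\<Sum>n=1..N. K N n * e n)" for N
  proof -
    have "(\<Sum>k. K N (Suc k) * e (Suc k)) = (\<Sum>k<N. K N (Suc k) * e (Suc k))"
      by (rule suminf_finite) (auto simp: K_eq_0)
    also have "\<dots> = (\<Sum>n=1..N. K N n * e n)"
      by (rule sum.reindex_bij_witness[of _ "\<lambda>k. k - 1" Suc]) auto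
    finally show ?thesis .
  qed
  moreover have "(\<lambda>k. e (Suc k)) sums L"
  proof -
    have "(\<Sum>k<N. e (Suc k)) = (\<Sum>n=1..N. e n)" for N
      by (rule sum.reindex_bij_witness[of _ "\<lambda>k. k - 1" Suc]) auto
    then show ?thesis using L by (simp add: sums_def)
  qed
  then have "(\<Sum>k. 4 / pi * e (Suc k)) = 4 / pi * L"
    using sums_mult sums_unique by metis
  ultimately have lim: "(\<lambda>N. \<Sum>n=1..N. K N n * e n) \<longlonglongrightarrow> 4 / pi * L"
    by simp
  have "\<forall>\<^sub>F N in sequentially. (\<Sum>n=1..N. K N n * e n) = star_sum s N"
    using eventually_ge_at_top[of 1] by eventually_elim (use e in \<open>simp add: expands_def\<close>)
  from Lim_transform_eventually[OF lim this] show ?thesis .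
qed

text \<open>The weights are nonnegative, so the truncated sums equal those of the absolute values;
  their convergence bounds them, and summability follows.\<close>

lemma tstar_eq_limit:
  assumes "star_sum s \<longlonglongrightarrow> l"
  shows "tstar s = l"
proof -
  let ?ws = "map (\<lambda>x k. 1 / od k ^ x) s"
  obtain B where B: "\<And>N. \<bar>star_sum s N\<bar> \<le> B"
    using assms convergent_imp_Bseq[OF convergentI] by (force simp: Bseq_def)
  have "nest (\<lambda>k. k) (map (\<lambda>w k. \<bar>w k\<bar>) ?ws) N = star_sum s N" for N
    unfolding star_sum_def using od_pos by (intro nest_abs_eq) (auto simp: less_imp_le)
  then have bd: "nest (\<lambda>k. k) (map (\<lambda>w k. \<bar>w k\<bar>) ?ws) N \<le> B" for N
    using B[of N] by (simp del: map_map)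
  have "nest (\<lambda>k. k) ?ws \<longlonglongrightarrow> infsum (\<lambda>ks. \<Prod>j<length ?ws. (?ws ! j) (ks ! j))
           {ks. length ks = length ?ws \<and> sorted_wrt (\<ge>) ks \<and> (\<forall>k\<in>set ks. 1 \<le> k)}"
    by (rule nest_tendsto_infsum[OF _ _ bd]) auto
  also have "infsum (\<lambda>ks. \<Prod>j<length ?ws. (?ws ! j) (ks ! j))
           {ks. length ks = length ?ws \<and> sorted_wrt (\<ge>) ks \<and> (\<forall>k\<in>set ks. 1 \<le> k)} = tstar s"
    by (simp add: tstar_def od_def)
  finally show ?thesis
    using assms LIMSEQ_unique unfolding star_sum_def by blast
qed


section \<open>Truncated alternating sums\<close>

definition tweight :: "nat \<times> bool \<Rightarrow> nat \<Rightarrow> real" where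
  "tweight = (\<lambda>(x, b) k. (if b then (-1) ^ k else 1) / od k ^ x)"

definition t_sum :: "(nat \<times> bool) list \<Rightarrow> nat \<Rightarrow> real" where
  "t_sum s = nest (\<lambda>k. k - 1) (map tweight s)"

lemma t_sum_Nil: "t_sum [] N = 1"
  by (simp add: t_sum_def)

lemma t_sum_Cons: "t_sum (xb # s) N = (\<Sum>k=1..N. tweight xb k * t_sum s (k - 1))"
  by (simp add: t_sum_def)

lemma abs_tweight_le:
  assumes "1 \<le> k" "m \<le> fst xb"
  shows "\<bar>tweight xb k\<bar> \<le> 1 / od k ^ m"
proof -
  have "\<bar>tweight xb k\<bar> = 1 / od k ^ fst xb"
    using od_pos[OF assms(1)] by (auto simp: tweight_def case_prod_unfold abs_divide power_abs)
  also have "\<dots> \<le> 1 / od k ^ m"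
    using od_ge_1[OF assms(1)] assms(2) by (intro divide_left_mono power_increasing) auto
  finally show ?thesis .
qed

text \<open>One majorant serves twice: the unsigned form yields absolute convergence of
  \<open>tval\<close>, the signed form the domination for Tannery's theorem.\<close>

lemma t_sum_term_le:
  assumes "\<forall>y\<in>set s. 1 \<le> fst y" "length s \<le> 2" "3 \<le> fst xb" "1 \<le> k"
  shows "\<bar>tweight xb k\<bar> * nest (\<lambda>k. k - 1) (map (\<lambda>w k. \<bar>w k\<bar>) (map tweight s)) (k - 1) \<le> 4 / (od k)\<^sup>2"
    and "\<bar>tweight xb k * t_sum s (k - 1)\<bar> \<le> 4 / (od k)\<^sup>2"
proof -
  show 1: "\<bar>tweight xb k\<bar> * nest (\<lambda>k. k - 1) (map (\<lambda>w k. \<bar>w k\<bar>) (map tweight s)) (k - 1) \<le> 4 / (od k)\<^sup>2"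
    using assms abs_tweight_le[of _ 1] abs_tweight_le[of k 3 xb]
    by (intro nest_pred_term_le) (auto simp del: map_map)
  have "\<bar>tweight xb k * t_sum s (k - 1)\<bar>
      \<le> \<bar>tweight xb k\<bar> * nest (\<lambda>k. k - 1) (map (\<lambda>w k. \<bar>w k\<bar>) (map tweight s)) (k - 1)"
    unfolding abs_mult t_sum_def by (intro mult_left_mono abs_nest_le) auto
  with 1 show "\<bar>tweight xb k * t_sum s (k - 1)\<bar> \<le> 4 / (od k)\<^sup>2" by linarith
qed

lemma t_sum_tendsto:
  assumes "\<forall>y\<in>set s. 1 \<le> fst y" "length s \<le> 2" "3 \<le> fst xb"
  shows "t_sum (xb # s) \<longlonglongrightarrow> tval (xb # s)"
proof -
  let ?ws = "map tweight (xb # s)"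
  \<comment> \<open>The constant is \<open>4 * 2\<close>, with 2 from
    \<open>sum_inverse_od_sq_le\<close>.\<close>
  have bd: "nest (\<lambda>k. k - 1) (map (\<lambda>w k. \<bar>w k\<bar>) ?ws) N \<le> 8" for N
  proof -
    have "nest (\<lambda>k. k - 1) (map (\<lambda>w k. \<bar>w k\<bar>) ?ws) N \<le> (\<Sum>k=1..N. 4 / (od k)\<^sup>2)"
      using t_sum_term_le(1)[OF assms] by (auto intro!: sum_mono simp del: map_map)
    also have "\<dots> = 4 * (\<Sum>k=1..N. 1 / (od k)\<^sup>2)"
      by (simp add: sum_distrib_left)
    finally show ?thesis using sum_inverse_od_sq_le[of N] by linarith
  qed
  have "nest (\<lambda>k. k - 1) ?ws \<longlonglongrightarrow> infsum (\<lambda>ks. \<Prod>j<length ?ws. (?ws ! j) (ks ! j))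
           {ks. length ks = length ?ws \<and> sorted_wrt (>) ks \<and> (\<forall>k\<in>set ks. 1 \<le> k)}"
    by (rule nest_tendsto_infsum[OF _ _ bd]) auto
  also have "infsum (\<lambda>ks. \<Prod>j<length ?ws. (?ws ! j) (ks ! j))
           {ks. length ks = length ?ws \<and> sorted_wrt (>) ks \<and> (\<forall>k\<in>set ks. 1 \<le> k)} = tval (xb # s)"
    unfolding tval_def length_map
    by (intro infsum_cong prod.cong refl) (simp add: nth_map tweight_def case_prod_unfold od_def del: list.map)
  finally show ?thesis unfolding t_sum_def .
qed

text \<open>Each of the two odd entries offers a diagonal term or twice a strict sum, whence the
  coefficients 1, 2, 2, 4. The kernel limit \<open>4 / pi\<close> turns them into 4, 8, 8, 16 over
  \<open>pi\<close>.\<close>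

lemma tstar_eq_tvals:
  assumes e: "expands s e"
    and x: "3 \<le> fst x1" "3 \<le> fst x2" "3 \<le> fst x3" "3 \<le> fst x4"
    and s: "1 \<le> fst y2" "1 \<le> fst y3" "1 \<le> fst y4" "1 \<le> fst z4"
    and eq: "\<And>m. 1 \<le> m \<Longrightarrow> e m = - (tweight x1 m + 2 * (tweight x2 m * t_sum [y2] (m - 1))
        + 2 * (tweight x3 m * t_sum [y3] (m - 1)) + 4 * (tweight x4 m * t_sum [y4, z4] (m - 1)))"
  shows "tstar s = - 4 / pi * tval [x1] - 8 / pi * tval [x2, y2] - 8 / pi * tval [x3, y3]
           - 16 / pi * tval [x4, y4, z4]"
proof -
  have sum: "(\<Sum>m=1..N. e m) = - (t_sum [x1] N + 2 * t_sum [x2, y2] N + 2 * t_sum [x3, y3] N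
      + 4 * t_sum [x4, y4, z4] N)" for N
  proof -
    have "(\<Sum>m=1..N. e m) = (\<Sum>m=1..N. - (tweight x1 m + 2 * (tweight x2 m * t_sum [y2] (m - 1))
        + 2 * (tweight x3 m * t_sum [y3] (m - 1)) + 4 * (tweight x4 m * t_sum [y4, z4] (m - 1))))"
      using eq by (intro sum.cong) auto
    also have "\<dots> = - ((\<Sum>m=1..N. tweight x1 m) + 2 * (\<Sum>m=1..N. tweight x2 m * t_sum [y2] (m - 1))
        + 2 * (\<Sum>m=1..N. tweight x3 m * t_sum [y3] (m - 1))
        + 4 * (\<Sum>m=1..N. tweight x4 m * t_sum [y4, z4] (m - 1)))"
      by (simp only: sum_negf sum.distrib sum_distrib_left)
    finally show ?thesis
      unfolding t_sum_Cons[of x1] t_sum_Cons[of x2] t_sum_Cons[of x3] t_sum_Cons[of x4] t_sum_Nil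
      by simp
  qed
  have "(\<lambda>N. \<Sum>m=1..N. e m) \<longlonglongrightarrow> - (tval [x1] + 2 * tval [x2, y2] + 2 * tval [x3, y3] + 4 * tval [x4, y4, z4])"
    unfolding sum using x s by (intro tendsto_intros t_sum_tendsto) auto
  \<comment> \<open>The constant is \<open>4 * (1 + 2 + 2 + 4)\<close>.\<close>
  moreover have "\<bar>e m\<bar> \<le> 36 / (od m)\<^sup>2" if m: "1 \<le> m" for m
  proof -
    have "\<bar>tweight x1 m * t_sum [] (m - 1)\<bar> \<le> 4 / (od m)\<^sup>2"
      "\<bar>tweight x2 m * t_sum [y2] (m - 1)\<bar> \<le> 4 / (od m)\<^sup>2"
      "\<bar>tweight x3 m * t_sum [y3] (m - 1)\<bar> \<le> 4 / (od m)\<^sup>2"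
      "\<bar>tweight x4 m * t_sum [y4, z4] (m - 1)\<bar> \<le> 4 / (od m)\<^sup>2"
      using x s m by (auto intro!: t_sum_term_le(2) simp del: One_nat_def)
    moreover have "36 / (od m)\<^sup>2 = 9 * (4 / (od m)\<^sup>2)" by simp
    ultimately show ?thesis unfolding eq[OF m] t_sum_Nil mult_1_right abs_le_iff by linarith
  qed
  ultimately have "star_sum s \<longlonglongrightarrow> 4 / pi * (- (tval [x1] + 2 * tval [x2, y2] + 2 * tval [x3, y3] + 4 * tval [x4, y4, z4]))"
    by (intro expands_tendsto[OF e]) auto
  from tstar_eq_limit[OF this] show ?thesis
    by (simp add: algebra_simps)
qed

section \<open>Assembly of the two evaluations\<close>

theorem theorem4p6:
  fixes a b c :: nat
  assumes "1 \<le> a"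
  shows "(tstar (replicate a 2 @ [1] @ replicate b 2 @ [3] @ replicate c 2) =
           - 4 / pi * tval [(2*a+2*b+2*c+5, True)]
           - 8 / pi * tval [(2*a+1, False), (2*b+2*c+4, True)]
           - 8 / pi * tval [(2*a+2*b+3, True), (2*c+2, False)]
           - 16 / pi * tval [(2*a+1, False), (2*b+2, True), (2*c+2, False)]) \<and>
         (tstar (replicate a 2 @ [1] @ replicate b 2 @ [1] @ replicate c 2) =
           - 4 / pi * tval [(2*a+2*b+2*c+3, True)]
           - 8 / pi * tval [(2*a+1, False), (2*b+2*c+2, True)]
           - 8 / pi * tval [(2*a+2*b+2, False), (2*c+1, True)]
           - 16 / pi * tval [(2*a+1, False), (2*b+1, False), (2*c+1, True)])"
proof
  define e0 where "e0 n = (-1) ^ (n + 1) / od n / od n ^ (2 * c)" for n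
  have e0: "expands (replicate c 2) e0"
    using expands_replicate_2[OF expands_Nil, of c] by (simp add: e0_def[abs_def])
  \<comment> \<open>The exponent \<open>n + 1\<close> of the sign, against \<open>n\<close> in a
    barred weight, is the source of the overall minus sign.\<close>
  have e0_eq: "e0 n = - tweight (2*c+1, True) n" for n
    by (simp add: e0_def tweight_def power_add mult.commute)
  show "tstar (replicate a 2 @ [1] @ replicate b 2 @ [1] @ replicate c 2) =
           - 4 / pi * tval [(2*a+2*b+2*c+3, True)]
           - 8 / pi * tval [(2*a+1, False), (2*b+2*c+2, True)]
           - 8 / pi * tval [(2*a+2*b+2, False), (2*c+1, True)]
           - 16 / pi * tval [(2*a+1, False), (2*b+1, False), (2*c+1, True)]"
  proof (rule tstar_eq_tvals)
    \<comment> \<open>The diagonal part merges the exponents \<open>2*c+1\<close>, 1 and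
      \<open>2*b\<close> into \<open>2*b+2*c+2\<close>; the strict sum keeps \<open>2*c+1\<close> as
      a separate inner index.\<close>
    define e1 where "e1 m = (e0 m + 2 * (\<Sum>n=1..m - 1. e0 n)) / od m / od m ^ (2 * b)" for m
    have e1: "expands (replicate b 2 @ [1] @ replicate c 2) e1"
      using expands_replicate_2[OF expands_1[OF e0], of b] by (simp add: e1_def[abs_def])
    define e2 where "e2 m = (e1 m + 2 * (\<Sum>n=1..m - 1. e1 n)) / od m / od m ^ (2 * a)" for m
    show "expands (replicate a 2 @ [1] @ replicate b 2 @ [1] @ replicate c 2) e2"
      using expands_replicate_2[OF expands_1[OF e1], of a] by (simp add: e2_def[abs_def])
    have sum_e0: "(\<Sum>n=1..m - 1. e0 n) = - t_sum [(2*c+1, True)] (m - 1)" for m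
      by (simp add: e0_eq t_sum_Cons t_sum_Nil sum_negf)
    have e1_eq: "e1 m = - (tweight (2*b+2*c+2, True) m
        + 2 * (tweight (2*b+1, False) m * t_sum [(2*c+1, True)] (m - 1)))" for m
    proof -
      have "e1 m = (e0 m + 2 * (- t_sum [(2*c+1, True)] (m - 1))) / od m / od m ^ (2 * b)"
        unfolding e1_def sum_e0 ..
      then show ?thesis
        by (simp add: e0_eq tweight_def power_add power2_eq_square add_divide_distrib diff_divide_distrib mult_ac)
    qed
    have sum_e1: "(\<Sum>n=1..m - 1. e1 n) = - (t_sum [(2*b+2*c+2, True)] (m - 1)
        + 2 * t_sum [(2*b+1, False), (2*c+1, True)] (m - 1))" for m
      unfolding e1_eq t_sum_Cons[of "(2*b+2*c+2, True)"] t_sum_Cons[of "(2*b+1, False)"] t_sum_Nil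
      by (simp add: sum_negf sum.distrib sum_distrib_left sum_subtractf)
    fix m :: nat
    \<comment> \<open>Inserting \<open>e1\<close> gives four terms: each of the two entries 1 either
      merges with what follows it or separates from it.\<close>
    have "e2 m = (e1 m + 2 * (- (t_sum [(2*b+2*c+2, True)] (m - 1)
        + 2 * t_sum [(2*b+1, False), (2*c+1, True)] (m - 1)))) / od m / od m ^ (2 * a)"
      unfolding e2_def sum_e1 ..
    then show "e2 m = - (tweight (2*a+2*b+2*c+3, True) m
        + 2 * (tweight (2*a+1, False) m * t_sum [(2*b+2*c+2, True)] (m - 1))
        + 2 * (tweight (2*a+2*b+2, False) m * t_sum [(2*c+1, True)] (m - 1))
        + 4 * (tweight (2*a+1, False) m * t_sum [(2*b+1, False), (2*c+1, True)] (m - 1)))"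
      by (simp add: e1_eq tweight_def power_add power2_eq_square power3_eq_cube add_divide_distrib
          diff_divide_distrib mult_ac)
  qed (use assms in auto)
  show "tstar (replicate a 2 @ [1] @ replicate b 2 @ [3] @ replicate c 2) =
           - 4 / pi * tval [(2*a+2*b+2*c+5, True)]
           - 8 / pi * tval [(2*a+1, False), (2*b+2*c+4, True)]
           - 8 / pi * tval [(2*a+2*b+3, True), (2*c+2, False)]
           - 16 / pi * tval [(2*a+1, False), (2*b+2, True), (2*c+2, False)]"
  proof (rule tstar_eq_tvals)
    define e1 where "e1 m = (e0 m / od m + 2 * (\<Sum>n=1..m - 1. (-1) ^ (m + n) * (e0 n / od n)))
        / (od m)\<^sup>2 / od m ^ (2 * b)" for m
    have e1: "expands (replicate b 2 @ [3] @ replicate c 2) e1"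
      using expands_replicate_2[OF expands_3[OF e0], of b] by (simp add: e1_def[abs_def])
    define e2 where "e2 m = (e1 m + 2 * (\<Sum>n=1..m - 1. e1 n)) / od m / od m ^ (2 * a)" for m
    show "expands (replicate a 2 @ [1] @ replicate b 2 @ [3] @ replicate c 2) e2"
      using expands_replicate_2[OF expands_1[OF e1], of a] by (simp add: e2_def[abs_def])
    \<comment> \<open>The factor \<open>(-1) ^ n\<close> cancels the sign of \<open>e0 n\<close> up
      to -1, so the inner index loses its bar; the remaining \<open>(-1) ^ m\<close> puts a bar on
      the outer index.\<close>
    have sum_e0: "(\<Sum>n=1..m - 1. (-1) ^ (m + n) * (e0 n / od n))
        = - ((-1) ^ m * t_sum [(2*c+2, False)] (m - 1))" for m
      unfolding t_sum_Cons t_sum_Nil sum_distrib_left sum_negf[symmetric]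
      by (intro sum.cong) (auto simp: e0_def tweight_def power_add power2_eq_square mult_ac simp flip: power_mult_distrib)
    have e1_eq: "e1 m = - (tweight (2*b+2*c+4, True) m
        + 2 * (tweight (2*b+2, True) m * t_sum [(2*c+2, False)] (m - 1)))" for m
    proof -
      have "e1 m = (e0 m / od m + 2 * (- ((-1) ^ m * t_sum [(2*c+2, False)] (m - 1))))
          / (od m)\<^sup>2 / od m ^ (2 * b)"
        unfolding e1_def sum_e0 ..
      then show ?thesis
        by (simp add: e0_eq tweight_def power_add power2_eq_square power4_eq_xxxx add_divide_distrib
            diff_divide_distrib mult_ac)
    qed
    have sum_e1: "(\<Sum>n=1..m - 1. e1 n) = - (t_sum [(2*b+2*c+4, True)] (m - 1)
        + 2 * t_sum [(2*b+2, True), (2*c+2, False)] (m - 1))" for m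
      unfolding e1_eq t_sum_Cons[of "(2*b+2*c+4, True)"] t_sum_Cons[of "(2*b+2, True)"] t_sum_Nil
      by (simp add: sum_negf sum.distrib sum_distrib_left sum_subtractf)
    fix m :: nat
    \<comment> \<open>The entry 1 introduces no sign, so the bars stay on the indices that carry
      them in \<open>e1\<close>.\<close>
    have "e2 m = (e1 m + 2 * (- (t_sum [(2*b+2*c+4, True)] (m - 1)
        + 2 * t_sum [(2*b+2, True), (2*c+2, False)] (m - 1)))) / od m / od m ^ (2 * a)"
      unfolding e2_def sum_e1 ..
    then show "e2 m = - (tweight (2*a+2*b+2*c+5, True) m
        + 2 * (tweight (2*a+1, False) m * t_sum [(2*b+2*c+4, True)] (m - 1))
        + 2 * (tweight (2*a+2*b+3, True) m * t_sum [(2*c+2, False)] (m - 1))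
        + 4 * (tweight (2*a+1, False) m * t_sum [(2*b+2, True), (2*c+2, False)] (m - 1)))"
      by (simp add: e1_eq tweight_def power_add power2_eq_square power3_eq_cube eval_nat_numeral
          add_divide_distrib diff_divide_distrib mult_ac)
  qed (use assms in auto)
qed

end
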